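(* Let $G$ be a Hausdorff topological group and let $S\subseteq G$ be a submonoid of $G$ which is open in $G$ and which is pseudocompact in the subspace topology. Then $S$ is a precompact closed subgroup of $G$.
   Context: A submonoid of a group $G$ is a subset $S\subseteq G$ with $SS\subseteq S$ that contains the neutral element $e$ of $G$. A space $X$ is pseudocompact if it is Tychonoff and every continuous map $f\colon X\to\mathbb{R}$ is bounded. A subset $A$ of a topological group $G$ is precompact in $G$ if for every neighborhood $V$ of $e$ there exists a finite set $K\subseteq G$ such that $A\subseteq KV$ and $A\subseteq VK$. *)

theory Defs
  imports "HOL-Analysis.Analysis" "HOL-Algebra.Coset"
begin

locale topological_group = group G for G (structure) +
  fixes T :: "'a topology"
  assumes topspace_eq: "topspace T = carrier G"
    and continuous_mult: "continuous_map (prod_topology T T) T (\<lambda>(x, y). x \<otimes> y)"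
    and continuous_inv: "continuous_map T T (\<lambda>x. inv x)"

definition tychonoff_space :: "'a topology \<Rightarrow> bool" where
  "tychonoff_space X \<longleftrightarrow> completely_regular_space X \<and> Hausdorff_space X"

definition pseudocompact_space :: "'a topology \<Rightarrow> bool" where
  "pseudocompact_space X \<longleftrightarrow>
     tychonoff_space X \<and>
     (\<forall>f. continuous_map X euclideanreal f \<longrightarrow> bounded (f ` topspace X))"

(* Neighborhoods need not be open. *)
definition neighborhood_in :: "'a topology \<Rightarrow> 'a \<Rightarrow> 'a set \<Rightarrow> bool" where
  "neighborhood_in X x V \<longleftrightarrow>
     V \<subseteq> topspace X \<and> (\<exists>U. openin X U \<and> x \<in> U \<and> U \<subseteq> V)"

definition precompact_in ::
    "('a, 'b) monoid_scheme \<Rightarrow> 'a topology \<Rightarrow> 'a set \<Rightarrow> bool" where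
  "precompact_in G T A \<longleftrightarrow>
     A \<subseteq> carrier G \<and>
     (\<forall>V. neighborhood_in T \<one>\<^bsub>G\<^esub> V \<longrightarrow>
        (\<exists>K. finite K \<and> K \<subseteq> carrier G \<and>
             A \<subseteq> K <#>\<^bsub>G\<^esub> V \<and> A \<subseteq> V <#>\<^bsub>G\<^esub> K))"

end

theory Submission
  imports Defs
begin

text \<open>
  In a pseudocompact space no sequence of nonempty open sets is locally finite. Were \<open>S\<close> not
  covered by finitely many translates \<open>xV\<close>, one could choose points of \<open>S\<close> that are pairwise
  \<open>V\<close>-separated, and their translates of a sufficiently small neighborhood would form such a
  sequence. Hence \<open>S\<close> is left precompact. Now let \<open>V\<close> be small compared with the neighborhood
  \<open>S\<close> of the identity: for \<open>s \<in> S\<close> two powers \<open>s\<^sup>n\<close>, \<open>s\<^sup>m\<close> with \<open>n < m\<close> lie in the same translate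
  of \<open>V\<close>, so \<open>s\<^sup>-\<^sup>m s\<^sup>n \<in> S\<close>, and multiplying by \<open>s\<close> to the power \<open>m - n - 1\<close> puts the inverse of
  \<open>s\<close> into \<open>S\<close>. Open subgroups are closed, and inversion turns left into right precompactness.
\<close>

text \<open>If the sequence were locally finite, bumps of height \<open>n\<close> supported in
  \<open>U n\<close> would add up to a continuous unbounded function.\<close>

lemma pseudocompact_space_open_sequence_cluster:
  fixes U :: "nat \<Rightarrow> 'a set"
  assumes X: "pseudocompact_space X"
    and opn: "\<And>n. openin X (U n)"
    and ne: "\<And>n. U n \<noteq> {}"
  obtains y where "y \<in> topspace X"
    and "\<And>N. openin X N \<Longrightarrow> y \<in> N \<Longrightarrow> infinite {n. U n \<inter> N \<noteq> {}}"
proof -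
  have cr: "completely_regular_space X"
    and bdd: "\<And>f. continuous_map X euclideanreal f \<Longrightarrow> bounded (f ` topspace X)"
    using X by (auto simp: pseudocompact_space_def tychonoff_space_def)
  have False if *: "\<forall>y\<in>topspace X. \<exists>N. openin X N \<and> y \<in> N \<and> finite {n. U n \<inter> N \<noteq> {}}"
  proof -
    have "\<exists>x. x \<in> U n" for n
      using ne by blast
    then obtain x where x: "\<And>n. x n \<in> U n"
      by metis
    have xX: "x n \<in> topspace X" for n
      using x opn openin_subset by blast
    have "\<exists>g. continuous_map X euclideanreal g \<and> g (x n) = 0 \<and> g ` (topspace X - U n) \<subseteq> {1}" for n
      using cr x xX opn unfolding completely_regular_space_alt
      by (metis DiffD2 DiffI closedin_diff closedin_topspace)
    then obtain g where g: "\<And>n. continuous_map X euclideanreal (g n)" "\<And>n. g n (x n) = 0"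
      "\<And>n. g n ` (topspace X - U n) \<subseteq> {1::real}"
      by metis
    \<comment> \<open>Flipping \<open>g n\<close> moves its zero set to the outside of
      \<open>U n\<close>. The absolute value keeps the bump nonnegative, since \<open>g n\<close> is
      not assumed to stay in [0,1].\<close>
    define h where "h n z = real n * \<bar>1 - g n z\<bar>" for n z
    have hcont: "continuous_map X euclideanreal (h n)" for n
      unfolding h_def by (intro continuous_intros g)
    have hx: "h n (x n) = n" for n
      by (simp add: h_def g)
    have h0: "h n z = 0" if "z \<in> topspace X" "z \<notin> U n" for n z
      using g(3)[of n] that by (auto simp: h_def)
    have hpos: "h n z \<ge> 0" for n z
      by (simp add: h_def)
    define f where "f z = (\<Sum>n | z \<in> U n. h n z)" for z
    obtain N where N: "\<And>y. y \<in> topspace X \<Longrightarrow> openin X (N y)"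
      "\<And>y. y \<in> topspace X \<Longrightarrow> y \<in> N y"
      "\<And>y. y \<in> topspace X \<Longrightarrow> finite {n. U n \<inter> N y \<noteq> {}}"
      using * by metis
    \<comment> \<open>On \<open>N y\<close> the index set, which depends on \<open>z\<close>, is
      enlarged to a fixed finite one; the added terms vanish. So \<open>f\<close> is locally a
      finite sum of continuous functions.\<close>
    have fsum: "f z = (\<Sum>n | U n \<inter> N y \<noteq> {}. h n z)" if "y \<in> topspace X" "z \<in> N y" for y z
      unfolding f_def
    proof (rule sum.mono_neutral_left)
      show "finite {n. U n \<inter> N y \<noteq> {}}"
        using N that by blast
      show "{n. z \<in> U n} \<subseteq> {n. U n \<inter> N y \<noteq> {}}"
        using that by blast
      have "z \<in> topspace X"
        using N(1) openin_subset that by blast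
      then show "\<forall>i\<in>{n. U n \<inter> N y \<noteq> {}} - {n. z \<in> U n}. h i z = 0"
        using h0 by blast
    qed
    have "continuous_map X euclideanreal f"
    proof (rule pasting_lemma[where I = "topspace X" and T = N and f = "\<lambda>_. f"])
      fix y assume y: "y \<in> topspace X"
      have "continuous_map (subtopology X (N y)) euclideanreal
              (\<lambda>z. \<Sum>n | U n \<inter> N y \<noteq> {}. h n z)"
        by (intro continuous_map_sum continuous_map_from_subtopology hcont N(3) y)
      then show "continuous_map (subtopology X (N y)) euclideanreal f"
        by (rule continuous_map_eq) (use fsum y in auto)
    qed (use N in auto)
    then obtain B where B: "\<And>z. z \<in> topspace X \<Longrightarrow> \<bar>f z\<bar> \<le> B"
      using bdd by (force simp: bounded_iff)
    obtain n where n: "B < real n"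
      using reals_Archimedean2 by blast
    have fin: "finite {m. x n \<in> U m}"
      by (rule finite_subset[OF _ N(3)[OF xX[of n]]]) (use N(2)[OF xX[of n]] in blast)
    have "h n (x n) \<le> f (x n)"
      unfolding f_def by (rule member_le_sum) (use x hpos fin in auto)
    then show False
      using B[OF xX[of n]] n hx[of n] by linarith
  qed
  then show thesis
    using that by blast
qed

context topological_group
begin

lemma continuous_map_mult_left:
  assumes "a \<in> carrier G"
  shows "continuous_map T T (\<lambda>x. a \<otimes> x)"
proof -
  have "continuous_map T (prod_topology T T) (\<lambda>x. (a, x))"
    using assms by (intro continuous_map_pairedI) (auto simp: topspace_eq)
  from continuous_map_compose[OF this continuous_mult] show ?thesis
    by (simp add: o_def)
qed

text \<open>The translate \<open>a W\<close> is written as the preimage of \<open>W\<close> under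
  left multiplication by \<open>inv a\<close>.\<close>

lemma openin_translate:
  assumes "a \<in> carrier G" "openin T W"
  shows "openin T {z \<in> carrier G. inv a \<otimes> z \<in> W}"
  using openin_continuous_map_preimage[OF continuous_map_mult_left[of "inv a"] assms(2)] assms(1)
  by (simp add: topspace_eq)

text \<open>Continuity of multiplication at \<open>(\<one>, \<one>)\<close> gives a neighborhood
  whose products lie in \<open>V\<close>; intersecting it with its inverse makes it
  symmetric.\<close>

lemma symmetric_square_root_neighborhood:
  assumes "openin T V" "\<one> \<in> V"
  obtains W where "openin T W" "\<one> \<in> W" "\<And>x. x \<in> W \<Longrightarrow> inv x \<in> W"
    "\<And>x y. x \<in> W \<Longrightarrow> y \<in> W \<Longrightarrow> x \<otimes> y \<in> V"
proof -
  have "openin (prod_topology T T)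
          {p \<in> topspace (prod_topology T T). (\<lambda>(x, y). x \<otimes> y) p \<in> V}"
    by (rule openin_continuous_map_preimage[OF continuous_mult assms(1)])
  moreover have "(\<one>, \<one>) \<in> {p \<in> topspace (prod_topology T T). (\<lambda>(x, y). x \<otimes> y) p \<in> V}"
    using assms by (auto simp: topspace_eq)
  ultimately obtain A B where AB: "openin T A" "openin T B" "\<one> \<in> A" "\<one> \<in> B"
    "A \<times> B \<subseteq> {p \<in> topspace (prod_topology T T). (\<lambda>(x, y). x \<otimes> y) p \<in> V}"
    unfolding openin_prod_topology_alt by meson
  define C where "C = A \<inter> B"
  define W where "W = C \<inter> {x \<in> topspace T. inv x \<in> C}"
  have C: "openin T C" "\<one> \<in> C"
    using AB by (auto simp: C_def)
  show thesis
  proof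
    show "openin T W"
      unfolding W_def
      by (intro openin_Int C openin_continuous_map_preimage[OF continuous_inv])
    show "\<one> \<in> W"
      using C by (simp add: W_def topspace_eq)
    show "inv x \<in> W" if "x \<in> W" for x
      using that by (auto simp: W_def topspace_eq)
    show "x \<otimes> y \<in> V" if "x \<in> W" "y \<in> W" for x y
      using that AB(5) by (auto simp: W_def C_def)
  qed
qed

lemma open_pseudocompact_finite_translates:
  assumes S: "openin T S" "pseudocompact_space (subtopology T S)"
    and V: "openin T V" "\<one> \<in> V"
  obtains K where "finite K" "K \<subseteq> S" "S \<subseteq> K <#> V"
proof -
  have Sc: "S \<subseteq> carrier G"
    using S openin_subset topspace_eq by auto
  obtain W' where W': "openin T W'" "\<one> \<in> W'" "\<And>x. x \<in> W' \<Longrightarrow> inv x \<in> W'"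
    "\<And>x y. x \<in> W' \<Longrightarrow> y \<in> W' \<Longrightarrow> x \<otimes> y \<in> V"
    using symmetric_square_root_neighborhood V by metis
  obtain W where W: "openin T W" "\<one> \<in> W" "\<And>x. x \<in> W \<Longrightarrow> inv x \<in> W"
    "\<And>x y. x \<in> W \<Longrightarrow> y \<in> W \<Longrightarrow> x \<otimes> y \<in> W'"
    using symmetric_square_root_neighborhood W' by metis
  have False if *: "\<not> (\<exists>K. finite K \<and> K \<subseteq> S \<and> S \<subseteq> K <#> V)"
  proof -
    \<comment> \<open>Greedy choice: the earlier points form a finite subset of \<open>S\<close>,
      whose translates of \<open>V\<close> miss some point of \<open>S\<close>.\<close>
    have "\<exists>x. \<forall>n::nat. x n \<in> S \<and> (\<forall>i<n. inv (x i) \<otimes> x n \<notin> V)"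
    proof (rule dependent_wellorder_choice
          [where P = "\<lambda>f n r. r \<in> S \<and> (\<forall>i<n. inv (f i) \<otimes> r \<notin> V)"])
      fix n :: nat and x :: "nat \<Rightarrow> 'a"
      assume IH: "\<And>k. k < n \<Longrightarrow> x k \<in> S \<and> (\<forall>i<k. inv (x i) \<otimes> x k \<notin> V)"
      have "finite (x ` {..<n})" "x ` {..<n} \<subseteq> S"
        using IH by auto
      with * obtain r where r: "r \<in> S" "r \<notin> x ` {..<n} <#> V"
        by blast
      have "inv (x i) \<otimes> r \<notin> V" if "i < n" for i
      proof
        assume "inv (x i) \<otimes> r \<in> V"
        moreover have "r = x i \<otimes> (inv (x i) \<otimes> r)"
          using IH[OF that] r Sc by (simp add: inv_solve_left' m_assoc[symmetric] subsetD)
        ultimately show False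
          using r(2) that unfolding set_mult_def by blast
      qed
      then show "\<exists>r. r \<in> S \<and> (\<forall>i<n. inv (x i) \<otimes> r \<notin> V)"
        using r(1) by blast
    qed auto
    then obtain x :: "nat \<Rightarrow> 'a" where x: "\<And>n. x n \<in> S"
      "\<And>i n. i < n \<Longrightarrow> inv (x i) \<otimes> x n \<notin> V"
      by metis
    have xc: "x n \<in> carrier G" for n
      using x Sc by blast
    \<comment> \<open>The trace of \<open>a W\<close> on \<open>S\<close>, so that pseudocompactness
      of the subspace applies and the cluster point lies in \<open>S\<close>.\<close>
    define U where "U a = S \<inter> {z \<in> carrier G. inv a \<otimes> z \<in> W}" for a
    have U: "openin (subtopology T S) (U a)" "a \<in> U a" if "a \<in> S" for a
      using that Sc W openin_translate[of a W] by (auto simp: U_def openin_subtopology_Int2 subsetD)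
    obtain y where y: "y \<in> topspace (subtopology T S)"
      "\<And>N. openin (subtopology T S) N \<Longrightarrow> y \<in> N \<Longrightarrow> infinite {n. U (x n) \<inter> N \<noteq> {}}"
      by (rule pseudocompact_space_open_sequence_cluster[OF S(2), of "\<lambda>n. U (x n)"])
        (use U x(1) in blast)+
    have yS: "y \<in> S" and yc: "y \<in> carrier G"
      using y(1) Sc by auto
    have inf: "infinite {n. U (x n) \<inter> U y \<noteq> {}}"
      using y(2) U yS by blast
    then obtain i where i: "U (x i) \<inter> U y \<noteq> {}"
      using infinite_imp_nonempty by blast
    \<comment> \<open>Infinitely many sets meet \<open>U y\<close>, so a second index beyond
      \<open>i\<close> is available.\<close>
    from inf obtain n where n: "i < n" "U (x n) \<inter> U y \<noteq> {}"
      unfolding infinite_nat_iff_unbounded by blast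
    have close: "inv (x m) \<otimes> y \<in> W'" if "U (x m) \<inter> U y \<noteq> {}" for m
    proof -
      from that obtain z where z: "z \<in> carrier G" "inv (x m) \<otimes> z \<in> W" "inv y \<otimes> z \<in> W"
        by (auto simp: U_def)
      \<comment> \<open>Passing through a common point \<open>z\<close> of the two translates costs
        one product in \<open>W\<close>; passing through \<open>y\<close> below costs one in
        \<open>W'\<close>. Hence the two successive square roots of \<open>V\<close>.\<close>
      have "inv (x m) \<otimes> y = (inv (x m) \<otimes> z) \<otimes> inv (inv y \<otimes> z)"
        using z(1) xc yc by (simp add: inv_mult_group m_assoc) (simp add: m_assoc[symmetric])
      then show ?thesis
        using W(3,4) z by simp
    qed
    have "inv (x i) \<otimes> x n = (inv (x i) \<otimes> y) \<otimes> inv (inv (x n) \<otimes> y)"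
      using xc yc by (simp add: inv_mult_group m_assoc) (simp add: m_assoc[symmetric])
    then have "inv (x i) \<otimes> x n \<in> V"
      using close i n(2) W'(3,4) by simp
    then show False
      using x(2) n(1) by blast
  qed
  then show thesis
    using that by blast
qed

text \<open>For \<open>a\<close> outside \<open>S\<close> the coset \<open>a S\<close> is an open
  neighborhood of \<open>a\<close> disjoint from \<open>S\<close>: a common point \<open>z\<close>
  would give \<open>a = z \<otimes> inv (inv a \<otimes> z)\<close> in \<open>S\<close>.\<close>

lemma open_subgroup_closedin:
  assumes "subgroup S G" "openin T S"
  shows "closedin T S"
proof -
  interpret S: subgroup S G by fact
  have "openin T (topspace T - S)"
  proof (subst openin_subopen, intro ballI)
    fix a assume a: "a \<in> topspace T - S"
    then have ac: "a \<in> carrier G"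
      by (simp add: topspace_eq)
    have "z \<notin> S" if "z \<in> carrier G" "inv a \<otimes> z \<in> S" for z
    proof
      assume "z \<in> S"
      then have "z \<otimes> inv (inv a \<otimes> z) \<in> S"
        using that by simp
      moreover have "z \<otimes> inv (inv a \<otimes> z) = a"
        using ac that by (simp add: inv_mult_group m_assoc[symmetric])
      ultimately show False
        using a by simp
    qed
    then have "{z \<in> carrier G. inv a \<otimes> z \<in> S} \<subseteq> topspace T - S"
      using topspace_eq by blast
    moreover have "a \<in> {z \<in> carrier G. inv a \<otimes> z \<in> S}"
      using ac by simp
    ultimately show "\<exists>N. openin T N \<and> a \<in> N \<and> N \<subseteq> topspace T - S"
      using openin_translate[OF ac assms(2)] by blast
  qed
  then show ?thesis
    using openin_subset[OF assms(2)] by (simp add: closedin_def)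
qed

lemma open_pseudocompact_submonoid_subgroup:
  assumes sub: "submonoid S G"
    and S: "openin T S" "pseudocompact_space (subtopology T S)"
  shows "subgroup S G"
proof -
  interpret S: submonoid S G by fact
  obtain W where W: "openin T W" "\<one> \<in> W" "\<And>x. x \<in> W \<Longrightarrow> inv x \<in> W"
    "\<And>x y. x \<in> W \<Longrightarrow> y \<in> W \<Longrightarrow> x \<otimes> y \<in> S"
    using symmetric_square_root_neighborhood[OF S(1)] by auto
  have Wc: "W \<subseteq> carrier G"
    using W(1) openin_subset topspace_eq by blast
  obtain K where K: "finite K" "K \<subseteq> S" "S \<subseteq> K <#> W"
    using open_pseudocompact_finite_translates[OF S W(1,2)] .
  have "inv s \<in> S" if s: "s \<in> S" for s
  proof -
    have sc: "s \<in> carrier G"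
      using s S.subset by blast
    have pow: "s [^] n \<in> S" for n :: nat
      by (induction n) (use s in auto)
    then have "\<exists>k v. k \<in> K \<and> v \<in> W \<and> s [^] n = k \<otimes> v" for n :: nat
      using K(3) unfolding set_mult_def by blast
    then obtain k v where kv: "\<And>n::nat. k n \<in> K" "\<And>n. v n \<in> W" "\<And>n. s [^] n = k n \<otimes> v n"
      by metis
    have "finite (range k)"
      by (rule finite_subset[OF _ K(1)]) (use kv(1) in auto)
    then have "\<not> inj k"
      by (metis finite_imageD infinite_UNIV_nat)
    then obtain n m where nm: "n < m" "k n = k m"
      by (metis injI linorder_neqE_nat)
    have c: "k m \<in> carrier G" "v n \<in> carrier G" "v m \<in> carrier G"
      using kv K(2) S.subset Wc by blast+
    \<comment> \<open>The common factor \<open>k n = k m\<close> cancels, and the symmetric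
      \<open>W\<close> was chosen with its products in \<open>S\<close>.\<close>
    have "inv (s [^] m) \<otimes> s [^] n = inv (v m) \<otimes> v n"
      using c nm(2) by (simp add: kv(3) inv_mult_group m_assoc) (simp add: m_assoc[symmetric])
    then have "inv (s [^] m) \<otimes> s [^] n \<in> S"
      using W kv(2) by simp
    \<comment> \<open>The total exponent is -1; as \<open>n < m\<close>, the subtraction on naturals
      does not truncate.\<close>
    then have "inv (s [^] m) \<otimes> s [^] n \<otimes> s [^] (m - n - 1) \<in> S"
      using pow by simp
    moreover have "inv (s [^] m) \<otimes> s [^] n \<otimes> s [^] (m - n - 1) = inv s"
    proof -
      have "inv (s [^] m) \<otimes> s [^] n \<otimes> s [^] (m - n - 1) = inv (s [^] m) \<otimes> s [^] (m - 1)"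
        using sc nm(1) by (simp add: m_assoc nat_pow_mult)
      moreover have "s [^] m = s [^] (m - 1) \<otimes> s"
        using nm(1) by (metis Suc_diff_1 nat_pow_Suc not_less_zero gr0I)
      ultimately show ?thesis
        using sc by (simp add: inv_mult_group m_assoc)
    qed
    ultimately show ?thesis
      by simp
  qed
  then show ?thesis
    using S.subset S.one_closed by (intro subgroupI) blast+
qed

text \<open>Since \<open>S\<close> is closed under inverses, inverting a covering by translates
  \<open>k W\<close> with \<open>W\<close> symmetric gives one by translates
  \<open>W (inv k)\<close>.\<close>

lemma open_pseudocompact_subgroup_precompact_in:
  assumes sub: "subgroup S G"
    and S: "openin T S" "pseudocompact_space (subtopology T S)"
  shows "precompact_in G T S"
  unfolding precompact_in_def
proof (intro conjI allI impI)
  interpret S: subgroup S G by fact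
  show "S \<subseteq> carrier G"
    by (rule S.subset)
  fix V assume "neighborhood_in T \<one> V"
  then obtain U where U: "openin T U" "\<one> \<in> U" "U \<subseteq> V"
    by (auto simp: neighborhood_in_def)
  obtain W where W: "openin T W" "\<one> \<in> W" "\<And>x. x \<in> W \<Longrightarrow> inv x \<in> W"
    "\<And>x y. x \<in> W \<Longrightarrow> y \<in> W \<Longrightarrow> x \<otimes> y \<in> U"
    using symmetric_square_root_neighborhood[OF U(1,2)] by blast
  have Wc: "W \<subseteq> carrier G"
    using W(1) openin_subset topspace_eq by blast
  have WV: "W \<subseteq> V"
    using W(2,4) U(3) Wc by (metis r_one subset_iff)
  obtain K where K: "finite K" "K \<subseteq> S" "S \<subseteq> K <#> W"
    using open_pseudocompact_finite_translates[OF S W(1,2)] .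
  \<comment> \<open>One finite set must serve both sides, so \<open>K\<close> is joined with its
    inverses.\<close>
  have "S \<subseteq> (K \<union> m_inv G ` K) <#> V"
    using K(3) WV unfolding set_mult_def by blast
  moreover have "S \<subseteq> V <#> (K \<union> m_inv G ` K)"
  proof
    fix s assume s: "s \<in> S"
    then obtain k w where kw: "k \<in> K" "w \<in> W" "inv s = k \<otimes> w"
      using K(3) S.m_inv_closed unfolding set_mult_def by blast
    have "s = inv (k \<otimes> w)"
      using s kw(3) by (metis S.mem_carrier inv_inv)
    also have "\<dots> = inv w \<otimes> inv k"
      using kw K(2) Wc by (simp add: inv_mult_group subsetD)
    finally show "s \<in> V <#> (K \<union> m_inv G ` K)"
      using kw W(3) WV unfolding set_mult_def by blast
  qed
  moreover have "finite (K \<union> m_inv G ` K)" "K \<union> m_inv G ` K \<subseteq> carrier G"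
    using K by auto
  ultimately show "\<exists>K. finite K \<and> K \<subseteq> carrier G \<and> S \<subseteq> K <#> V \<and> S \<subseteq> V <#> K"
    by blast
qed

end

theorem theorem2p7:
  fixes G :: "('a, 'b) monoid_scheme" and T :: "'a topology" and S :: "'a set"
  assumes "topological_group G T"
    and "Hausdorff_space T"
    and "submonoid S G"
    and "openin T S"
    and "pseudocompact_space (subtopology T S)"
  shows "subgroup S G \<and> closedin T S \<and> precompact_in G T S"
proof -
  interpret topological_group G T by fact
  have "subgroup S G"
    using open_pseudocompact_submonoid_subgroup assms by blast
  then show ?thesis
    using open_subgroup_closedin open_pseudocompact_subgroup_precompact_in assms by blast
qed

end
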